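(* Let $R$ be a commutative ring with unity, let $S\subseteq R$ be a multiplicatively closed subset, suppose $R$ is an $S$-Artinian ring, and let $P$ be an $S$-prime ideal of $R$. Then $R/P$ is an $\overline{S}$-field, where $\overline{S}=\{s+P\mid s\in S\}$ is a multiplicatively closed subset of $R/P$.
   Context: A multiplicatively closed subset $S$ of a commutative ring $R$ is a subset with $1\in S$, $0\notin S$, and $st\in S$ for all $s,t\in S$. The ring $R$ is $S$-Artinian if for every descending chain of ideals $I_1\supseteq I_2\supseteq\cdots\supseteq I_n\supseteq\cdots$ of $R$ there exist $s\in S$ and $k\in\mathbb{N}$ such that $sI_k\subseteq I_n$ for all $n\geq k$. An ideal $P$ of $R$ with $P\cap S=\emptyset$ is $S$-prime if there exists $s\in S$ such that for all $a,b\in R$ with $ab\in P$, either $sa\in P$ or $sb\in P$. For a commutative ring $A$ with multiplicatively closed subset $T$: an ideal $I$ of $A$ with $I\cap T=\emptyset$ is $T$-maximal if there exists $t\in T$ such that for every ideal $J$ of $A$ with $I\subseteq J$, either $tJ\subseteq I$ or $J\cap T\neq\emptyset$; and $A$ is a $T$-field if its zero ideal is a $T$-maximal ideal of $A$. *)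

theory Defs
  imports "HOL-Algebra.QuotRing"
begin

locale mult_closed_subset = cring R for R (structure) +
  fixes S :: "'a set"
  assumes subset_carrier: "S \<subseteq> carrier R"
    and one_mem: "\<one> \<in> S"
    and zero_not_mem: "\<zero> \<notin> S"
    and mult_mem: "\<lbrakk>s \<in> S; t \<in> S\<rbrakk> \<Longrightarrow> s \<otimes> t \<in> S"

text \<open>
  The product \<open>s I\<close> of a ring element and an ideal is the multiplicative left coset
  \<open>s <# I = {s \<otimes> x | x \<in> I}\<close>. The predicates below are meant for a commutative ring \<open>R\<close>
  with a multiplicatively closed subset \<open>S\<close>; they do not themselves assert
  \<^const>\<open>mult_closed_subset\<close>.
\<close>

definition S_artinian :: "('a, 'b) ring_scheme \<Rightarrow> 'a set \<Rightarrow> bool" where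
  "S_artinian R S \<longleftrightarrow>
     (\<forall>I :: nat \<Rightarrow> 'a set. (\<forall>n. ideal (I n) R) \<and> (\<forall>n. I (Suc n) \<subseteq> I n) \<longrightarrow>
        (\<exists>s\<in>S. \<exists>k. \<forall>n\<ge>k. s <#\<^bsub>R\<^esub> I k \<subseteq> I n))"

definition S_prime_ideal :: "('a, 'b) ring_scheme \<Rightarrow> 'a set \<Rightarrow> 'a set \<Rightarrow> bool" where
  "S_prime_ideal R S P \<longleftrightarrow> ideal P R \<and> P \<inter> S = {} \<and>
     (\<exists>s\<in>S. \<forall>a\<in>carrier R. \<forall>b\<in>carrier R.
        a \<otimes>\<^bsub>R\<^esub> b \<in> P \<longrightarrow> s \<otimes>\<^bsub>R\<^esub> a \<in> P \<or> s \<otimes>\<^bsub>R\<^esub> b \<in> P)"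

definition S_maximal_ideal :: "('a, 'b) ring_scheme \<Rightarrow> 'a set \<Rightarrow> 'a set \<Rightarrow> bool" where
  "S_maximal_ideal R S I \<longleftrightarrow> ideal I R \<and> I \<inter> S = {} \<and>
     (\<exists>s\<in>S. \<forall>J. ideal J R \<and> I \<subseteq> J \<longrightarrow> s <#\<^bsub>R\<^esub> J \<subseteq> I \<or> J \<inter> S \<noteq> {})"

definition S_field :: "('a, 'b) ring_scheme \<Rightarrow> 'a set \<Rightarrow> bool" where
  "S_field R S \<longleftrightarrow> S_maximal_ideal R S {\<zero>\<^bsub>R\<^esub>}"

definition coset_image :: "('a, 'b) ring_scheme \<Rightarrow> 'a set \<Rightarrow> 'a set \<Rightarrow> 'a set set" where
  "coset_image R P S = (\<lambda>s. P +>\<^bsub>R\<^esub> s) ` S"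

end

theory Submission
  imports Defs
begin

text \<open>
  Let \<open>t\<close> witness that \<open>P\<close> is \<open>S\<close>-prime. The point is that this single \<open>t\<close> also witnesses
  that the zero ideal of \<open>R/P\<close> is maximal, uniformly in the competing ideal, because of a dichotomy
  for elements: for every \<open>a\<close>, either \<open>t a \<in> P\<close>, or some multiple of \<open>a\<close> is congruent modulo \<open>P\<close>
  to an element of \<open>S\<close>. An ideal of \<open>R/P\<close> that contains the class of an \<open>a\<close> of the second kind
  meets the image of \<open>S\<close>, and an ideal containing only classes of the first kind is killed by the
  class of \<open>t\<close>.

  For the dichotomy, apply the Artinian condition to the chain of principal ideals \<open>(a\<^sup>n)\<close>: it
  gives \<open>s a\<^sup>k = r a\<^sup>k\<^sup>+\<^sup>1\<close> with \<open>s \<in> S\<close>, so that \<open>a\<^sup>k (s - r a) = 0 \<in> P\<close>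
  (lemma \<open>S_artinian_power\<close>). By primeness either \<open>t (s - r a) \<in> P\<close>, which makes \<open>(t r) a\<close>
  congruent to \<open>t s \<in> S\<close>, or \<open>t a\<^sup>k \<in> P\<close>, and then primeness lets one strip off the power and
  leaves \<open>t a \<in> P\<close> (lemma \<open>S_prime_power\<close>).
\<close>

lemma (in mult_closed_subset) S_artinian_power:
  assumes art: "S_artinian R S" and a: "a \<in> carrier R"
  obtains s r and k :: nat
  where "s \<in> S" "r \<in> carrier R" "a [^] k \<otimes> (s \<ominus> r \<otimes> a) = \<zero>"
proof -
  define I where "I n = PIdl (a [^] n)" for n :: nat
  have "ideal (I n) R" for n
    unfolding I_def using a by (intro cgenideal_ideal) simp
  moreover have "I (Suc n) \<subseteq> I n" for n
  proof
    fix x assume "x \<in> I (Suc n)"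
    then obtain y where y: "y \<in> carrier R" "x = y \<otimes> a [^] Suc n"
      unfolding I_def cgenideal_def by auto
    then have "x = (y \<otimes> a) \<otimes> a [^] n"
      using a by (simp add: m_ac)
    then show "x \<in> I n"
      unfolding I_def cgenideal_def using y a by blast
  qed
  ultimately obtain s k where s: "s \<in> S" and sub: "\<forall>n\<ge>k. s <# I k \<subseteq> I n"
    using art unfolding S_artinian_def by blast
  have sR: "s \<in> carrier R" using s subset_carrier by blast
  have "a [^] k \<in> I k"
    unfolding I_def using a by (intro cgenideal_self) simp
  then have "s \<otimes> a [^] k \<in> I (Suc k)"
    using sub[rule_format, of "Suc k"] unfolding l_coset_def by auto
  then obtain r where r: "r \<in> carrier R" "s \<otimes> a [^] k = r \<otimes> a [^] Suc k"
    unfolding I_def cgenideal_def by auto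
  have "a [^] k \<otimes> (s \<ominus> r \<otimes> a) = s \<otimes> a [^] k \<ominus> r \<otimes> a [^] Suc k"
    using a r(1) sR by (simp add: minus_eq r_distr r_minus m_ac)
  also have "\<dots> = \<zero>"
    using a r sR by (simp add: minus_eq r_neg)
  finally show thesis using that s r(1) by blast
qed

text \<open>
  An \<open>S\<close>-prime ideal behaves like a prime ideal up to the factor \<open>t\<close>: factors from \<open>S\<close> can be
  traded for \<open>t\<close>. Without this trade, each descent from \<open>a\<^sup>n\<^sup>+\<^sup>1\<close> to \<open>a\<^sup>n\<close> would accumulate
  another factor \<open>t\<close>.
\<close>

lemma (in mult_closed_subset) S_prime_power:
  assumes t: "t \<in> S" and disj: "P \<inter> S = {}"
    and prime: "\<And>x y. \<lbrakk>x \<in> carrier R; y \<in> carrier R; x \<otimes> y \<in> P\<rbrakk> \<Longrightarrow> t \<otimes> x \<in> P \<or> t \<otimes> y \<in> P"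
    and a: "a \<in> carrier R" and "t \<otimes> a [^] (n::nat) \<in> P"
  shows "t \<otimes> a \<in> P"
  using \<open>t \<otimes> a [^] n \<in> P\<close>
proof (induction n)
  case 0
  then have "t \<in> P" using t subset_carrier by auto
  then show ?case using t disj by blast
next
  case (Suc n)
  have tR: "t \<in> carrier R" using t subset_carrier by blast
  have trade: "t \<otimes> x \<in> P" if "c \<in> S" "x \<in> carrier R" "c \<otimes> x \<in> P" for c x
    using prime[of c x] that mult_mem[OF t that(1)] disj subset_carrier by blast
  have "t \<otimes> a [^] Suc n = (t \<otimes> a [^] n) \<otimes> a"
    using tR a by (simp add: m_assoc)
  then have "t \<otimes> (t \<otimes> a [^] n) \<in> P \<or> t \<otimes> a \<in> P"
    using prime[of "t \<otimes> a [^] n" a] Suc.prems tR a by simp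
  moreover have "t \<otimes> a [^] n \<in> P" if "t \<otimes> (t \<otimes> a [^] n) \<in> P"
    using trade[of "t \<otimes> t" "a [^] n"] that mult_mem[OF t t] tR a by (simp add: m_assoc)
  ultimately show ?case using Suc.IH by blast
qed

text \<open>
  The dichotomy is phrased with cosets, since the second alternative is used inside \<open>R/P\<close>.
\<close>

lemma (in mult_closed_subset) S_artinian_S_prime_dichotomy:
  assumes art: "S_artinian R S" and P: "ideal P R"
    and t: "t \<in> S" and disj: "P \<inter> S = {}"
    and prime: "\<And>x y. \<lbrakk>x \<in> carrier R; y \<in> carrier R; x \<otimes> y \<in> P\<rbrakk> \<Longrightarrow> t \<otimes> x \<in> P \<or> t \<otimes> y \<in> P"
    and a: "a \<in> carrier R"
  shows "t \<otimes> a \<in> P \<or> (\<exists>r\<in>carrier R. P +> r \<otimes> a \<in> coset_image R P S)"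
proof -
  interpret P: ideal P R by (fact P)
  obtain s r and k :: nat where s: "s \<in> S" and r: "r \<in> carrier R"
    and eq: "a [^] k \<otimes> (s \<ominus> r \<otimes> a) = \<zero>"
    using S_artinian_power[OF art a] .
  have R: "s \<in> carrier R" "t \<in> carrier R" using s t subset_carrier by auto
  have "t \<otimes> a [^] k \<in> P \<or> t \<otimes> (s \<ominus> r \<otimes> a) \<in> P"
    using prime[of "a [^] k" "s \<ominus> r \<otimes> a"] eq a r R by simp
  then show ?thesis
  proof
    assume "t \<otimes> a [^] k \<in> P"
    then show ?thesis using S_prime_power[OF t disj prime a] by blast
  next
    assume *: "t \<otimes> (s \<ominus> r \<otimes> a) \<in> P"
    have "t \<otimes> (s \<ominus> r \<otimes> a) = t \<otimes> s \<ominus> (t \<otimes> r) \<otimes> a"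
      using R r a by (simp add: minus_eq r_distr r_minus m_assoc)
    then have "P +> t \<otimes> s = P +> (t \<otimes> r) \<otimes> a"
      using * R r a by (simp add: quotient_eq_iff_same_a_r_cos[OF P])
    then have "P +> (t \<otimes> r) \<otimes> a \<in> coset_image R P S"
      unfolding coset_image_def using mult_mem[OF t s] by (metis imageI)
    then show ?thesis using R r by blast
  qed
qed

lemma (in mult_closed_subset) mult_closed_subset_coset_image:
  assumes P: "ideal P R" and disj: "P \<inter> S = {}"
  shows "mult_closed_subset (R Quot P) (coset_image R P S)"
proof -
  interpret P: ideal P R by (fact P)
  interpret Q: cring "R Quot P" by (rule P.quotient_is_cring[OF is_cring])
  have hom: "(+>) P \<in> ring_hom R (R Quot P)" by (rule P.rcos_ring_hom)
  show ?thesis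
  proof
    show "coset_image R P S \<subseteq> carrier (R Quot P)"
      unfolding coset_image_def using subset_carrier ring_hom_closed[OF hom] by blast
    show "\<one>\<^bsub>R Quot P\<^esub> \<in> coset_image R P S"
      unfolding coset_image_def using one_mem ring_hom_one[OF hom] by (metis imageI)
    show "\<zero>\<^bsub>R Quot P\<^esub> \<notin> coset_image R P S"
    proof
      assume "\<zero>\<^bsub>R Quot P\<^esub> \<in> coset_image R P S"
      then obtain s where "s \<in> S" "P +> s = P"
        unfolding coset_image_def by (auto simp: FactRing_def)
      then show False
        using P.a_rcos_self[of s] subset_carrier disj by auto
    qed
  next
    fix x y assume "x \<in> coset_image R P S" "y \<in> coset_image R P S"
    then obtain s u where su: "s \<in> S" "u \<in> S" "x = P +> s" "y = P +> u"
      unfolding coset_image_def by blast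
    then have "x \<otimes>\<^bsub>R Quot P\<^esub> y = P +> s \<otimes> u"
      using ring_hom_mult[OF hom] subset_carrier by auto
    then show "x \<otimes>\<^bsub>R Quot P\<^esub> y \<in> coset_image R P S"
      unfolding coset_image_def using su mult_mem by blast
  qed
qed

theorem theorem3p13:
  fixes R :: "('a, 'b) ring_scheme" (structure)
    and S P :: "'a set"
  assumes "cring R"
    and "mult_closed_subset R S"
    and "S_artinian R S"
    and "S_prime_ideal R S P"
  shows "mult_closed_subset (R Quot P) (coset_image R P S) \<and>
         S_field (R Quot P) (coset_image R P S)"
proof -
  interpret mult_closed_subset R S by (fact assms(2))
  from assms(4) obtain t where P: "ideal P R" and disj: "P \<inter> S = {}" and t: "t \<in> S"
    and prime: "\<And>x y. \<lbrakk>x \<in> carrier R; y \<in> carrier R; x \<otimes> y \<in> P\<rbrakk> \<Longrightarrow> t \<otimes> x \<in> P \<or> t \<otimes> y \<in> P"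
    unfolding S_prime_ideal_def by blast
  interpret P: ideal P R by (fact P)
  interpret Q: mult_closed_subset "R Quot P" "coset_image R P S"
    by (rule mult_closed_subset_coset_image[OF P disj])
  have hom: "(+>) P \<in> ring_hom R (R Quot P)" by (rule P.rcos_ring_hom)
  have tR: "t \<in> carrier R" using t subset_carrier by blast
  have "(P +> t) <#\<^bsub>R Quot P\<^esub> J \<subseteq> {\<zero>\<^bsub>R Quot P\<^esub>}"
    if J: "ideal J (R Quot P)" and JS: "J \<inter> coset_image R P S = {}" for J
  proof
    interpret J: ideal J "R Quot P" by (fact J)
    fix z assume "z \<in> (P +> t) <#\<^bsub>R Quot P\<^esub> J"
    then obtain x where x: "x \<in> J" and z: "z = (P +> t) \<otimes>\<^bsub>R Quot P\<^esub> x"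
      unfolding l_coset_def by blast
    obtain a where a: "a \<in> carrier R" and xa: "x = P +> a"
      using J.Icarr[OF x] by (auto simp: FactRing_def A_RCOSETS_def')
    have "P +> r \<otimes> a \<in> J" if "r \<in> carrier R" for r
      using J.I_l_closed[OF x ring_hom_closed[OF hom that]] ring_hom_mult[OF hom that a]
      by (simp add: xa)
    then have "t \<otimes> a \<in> P"
      using S_artinian_S_prime_dichotomy[OF assms(3) P t disj prime a] JS by blast
    then have "P +> t \<otimes> a = \<zero>\<^bsub>R Quot P\<^esub>"
      by (simp add: P.a_rcos_const FactRing_def)
    then show "z \<in> {\<zero>\<^bsub>R Quot P\<^esub>}"
      using ring_hom_mult[OF hom tR a] z xa by simp
  qed
  moreover have "P +> t \<in> coset_image R P S"
    unfolding coset_image_def using t by blast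
  ultimately have "S_field (R Quot P) (coset_image R P S)"
    unfolding S_field_def S_maximal_ideal_def
    using Q.zeroideal Q.zero_not_mem by blast
  then show ?thesis using Q.mult_closed_subset_axioms by blast
qed

end
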